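(* An infinite word $x \in \{0,1\}^{\mathbb{N}}$ is Sturmian if and only if \[ W(\overline{\mathcal{O}(x)}) = \mathcal{B}^{-1}(A^*BA^* ) \subset \{A,B\}^{\mathbb{N}}. \]
   Context: $0\in\mathbb N$. $\sigma$ is the shift map on $\{0,1\}^{\mathbb{N}}$, $\sigma(x)_i=x_{i+1}$, and $\overline{\mathcal{O}(x)}$ is the closure (product topology) of the orbit $\{\sigma^n(x) : n\in\mathbb{N}\}$. $\mathcal{B}_n(X)$ is the set of words of length $n$ appearing as contiguous factors of points of $X$. A word $x \in\{0,1\}^{\mathbb{N}}$ is Sturmian if $|\mathcal{B}_n(\overline{\mathcal{O}(x)})| = n+1$ for all $n\in\mathbb{N}$. $\mathcal{B}^{-1}(A^*BA^* ) \subset \{A,B\}^{\mathbb{N}}$ is the subshift whose language is the set of factors of words in $A^*BA^*$, i.e. the set of all $a\in\{A,B\}^{\mathbb{N}}$ containing at most one occurrence of $B$. Winning shift: for $X\subset\{0,1\}^{\mathbb{N}}$ and a turn order $a\in\{A,B\}^{\mathbb{N}}$, two players $A$ and $B$ build an infinite word $w\in\{0,1\}^{\mathbb{N}}$ letter by letter starting from coordinate $0$; $w_i$ is chosen by player $a_i$, knowing $w_0\cdots w_{i-1}$. $A$ wins if $w\in X$, otherwise $B$ wins. A strategy is a function from finite words to letters, and a strategy of $A$ is winning if the resulting word lies in $X$ whatever strategy $B$ uses. $W(X)$ is the set of all $a\in\{A,B\}^{\mathbb{N}}$ for which $A$ has a winning strategy. *)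

theory Defs
  imports "HOL-Analysis.Analysis" "HOL-Library.Sublist"
begin

text \<open>The binary alphabet \<open>{0,1}\<close> is the type \<^typ>\<open>bool\<close>, with \<open>0\<close> as \<^term>\<open>False\<close> and \<open>1\<close> as
  \<^term>\<open>True\<close>.  Its topology is discrete, so the library topology on \<^typ>\<open>nat \<Rightarrow> bool\<close> is the
  product topology on infinite binary words.\<close>

datatype player = A | B

definition shift :: "(nat \<Rightarrow> 'a) \<Rightarrow> nat \<Rightarrow> 'a" where
  "shift x = (\<lambda>i. x (Suc i))"

definition orbit_closure :: "(nat \<Rightarrow> 'a::topological_space) \<Rightarrow> (nat \<Rightarrow> 'a) set" where
  "orbit_closure x = closure {(shift ^^ n) x | n. True}"

definition words_of_length :: "nat \<Rightarrow> (nat \<Rightarrow> 'a) set \<Rightarrow> 'a list set" where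
  "words_of_length n X = {map x [k..<k + n] | x k. x \<in> X}"

definition language :: "(nat \<Rightarrow> 'a) set \<Rightarrow> 'a list set" where
  "language X = (\<Union>n. words_of_length n X)"

definition sturmian :: "(nat \<Rightarrow> bool) \<Rightarrow> bool" where
  "sturmian x \<longleftrightarrow> (\<forall>n. card (words_of_length n (orbit_closure x)) = n + 1)"

text \<open>The subshift \<open>\<B>\<inverse>(L)\<close>: all infinite words whose finite factors are factors of words in \<open>L\<close>.\<close>

definition inverse_language :: "'a list set \<Rightarrow> (nat \<Rightarrow> 'a) set" where
  "inverse_language L = {a. language {a} \<subseteq> {v. \<exists>u\<in>L. sublist v u}}"

definition AstarBAstar :: "player list set" where
  "AstarBAstar = {replicate m A @ [B] @ replicate n A | m n. True}"

text \<open>A strategy maps the word built so far to the next letter.\<close>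

type_synonym strategy = "bool list \<Rightarrow> bool"

primrec play_prefix :: "(nat \<Rightarrow> player) \<Rightarrow> strategy \<Rightarrow> strategy \<Rightarrow> nat \<Rightarrow> bool list" where
  "play_prefix a sA sB 0 = []"
| "play_prefix a sA sB (Suc n) =
     (let p = play_prefix a sA sB n
      in p @ [case a n of A \<Rightarrow> sA p | B \<Rightarrow> sB p])"

definition play :: "(nat \<Rightarrow> player) \<Rightarrow> strategy \<Rightarrow> strategy \<Rightarrow> nat \<Rightarrow> bool" where
  "play a sA sB i = play_prefix a sA sB (Suc i) ! i"

definition winning_shift :: "(nat \<Rightarrow> bool) set \<Rightarrow> (nat \<Rightarrow> player) set" where
  "winning_shift X = {a. \<exists>sA. \<forall>sB. play a sA sB \<in> X}"

lemma play_prefix_eq: "play_prefix a sA sB n = map (play a sA sB) [0..<n]"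
proof (induction n)
  case (Suc n)
  have "length (play_prefix a sA sB n) = n" using Suc by simp
  then have "play a sA sB n = (case a n of A \<Rightarrow> sA (play_prefix a sA sB n) | B \<Rightarrow> sB (play_prefix a sA sB n))"
    by (simp add: play_def Let_def nth_append)
  then show ?case using Suc by (cases "a n") (simp_all add: Let_def)
qed simp

lemma play_rec:
  "play a sA sB n =
     (case a n of A \<Rightarrow> sA (map (play a sA sB) [0..<n]) | B \<Rightarrow> sB (map (play a sA sB) [0..<n]))"
proof -
  have "length (play_prefix a sA sB n) = n" by (simp add: play_prefix_eq)
  then have "play a sA sB n = (case a n of A \<Rightarrow> sA (play_prefix a sA sB n) | B \<Rightarrow> sB (play_prefix a sA sB n))"
    by (simp add: play_def Let_def nth_append)
  then show ?thesis by (simp only: play_prefix_eq)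
qed

lemma inverse_language_AstarBAstar:
  "inverse_language AstarBAstar = {a. \<forall>i j. a i = B \<and> a j = B \<longrightarrow> i = j}"
proof (intro set_eqI iffI)
  fix a assume a: "a \<in> inverse_language AstarBAstar"
  have False if ij: "i < j" "a i = B" "a j = B" for i j
  proof -
    let ?v = "map a [i..<i + Suc (j - i)]"
    have "?v \<in> language {a}" unfolding language_def words_of_length_def by blast
    then obtain m n where "sublist ?v (replicate m A @ [B] @ replicate n A)"
      using a unfolding inverse_language_def AstarBAstar_def by blast
    then obtain p s where e: "replicate m A @ [B] @ replicate n A = p @ ?v @ s"
      by (auto simp: sublist_def)
    have "length (filter ((=) B) ?v) \<le> length (filter ((=) B) (p @ ?v @ s))" by simp
    also have "\<dots> = 1" unfolding e[symmetric] by simp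
    finally have "length (filter ((=) B) ?v) \<le> 1" .
    moreover have "?v = a i # map a [Suc i..<j] @ [a j]"
      using ij(1) by (simp add: upt_Suc_append upt_conv_Cons[of i j])
    ultimately have "length (filter ((=) B) (a i # map a [Suc i..<j] @ [a j])) \<le> 1"
      by (simp only:)
    then show False using ij(2,3) by simp
  qed
  then show "a \<in> {a. \<forall>i j. a i = B \<and> a j = B \<longrightarrow> i = j}"
    by (blast elim: linorder_neqE_nat)
next
  fix a :: "nat \<Rightarrow> player" assume "a \<in> {a. \<forall>i j. a i = B \<and> a j = B \<longrightarrow> i = j}"
  then have u: "a i = B \<Longrightarrow> a j = B \<Longrightarrow> i = j" for i j by blast
  have "\<exists>u\<in>AstarBAstar. sublist (map a [k..<k + n]) u" for k n
  proof (cases "\<exists>i\<in>{k..<k+n}. a i = B")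
    case True
    then obtain i where i: "k \<le> i" "i < k + n" "a i = B" by auto
    have o: "a j = A" if "j \<noteq> i" for j using u[OF i(3), of j] that by (cases "a j") auto
    have "[k..<k + n] = [k..<i] @ i # [Suc i..<k+n]"
      using i(1,2) upt_add_eq_append[of k i "k + n - i"] upt_conv_Cons[of i "k + n"] by simp
    moreover have "map a [k..<i] = replicate (i - k) A"
      by (rule replicate_eqI) (auto simp: o)
    moreover have "map a [Suc i..<k+n] = replicate (k + n - Suc i) A"
      by (rule replicate_eqI) (auto simp: o)
    ultimately have "map a [k..<k + n] = replicate (i - k) A @ [B] @ replicate (k + n - Suc i) A"
      using i(3) by simp
    then have "map a [k..<k + n] \<in> AstarBAstar" unfolding AstarBAstar_def by blast
    then show ?thesis by (rule bexI[rotated]) simp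
  next
    case False
    then have "map a [k..<k+n] = replicate n A"
      by (intro replicate_eqI) (auto intro: player.exhaust)
    then have "sublist (map a [k..<k+n]) (replicate n A @ [B] @ replicate 0 A)" by simp
    then show ?thesis unfolding AstarBAstar_def by blast
  qed
  then show "a \<in> inverse_language AstarBAstar"
    unfolding inverse_language_def language_def words_of_length_def by auto
qed

end

theory Submission
  imports Defs
begin

text \<open>The finite version of the game has a counting invariant: for a finite set \<open>S\<close> of words of
  length \<open>n\<close>, exactly \<open>card S\<close> turn orders of length \<open>n\<close> are won by \<open>A\<close>.  Indeed, if \<open>S\<^sub>0\<close> and \<open>S\<^sub>1\<close>
  are the sets of continuations after the first letter, the turn orders won on \<open>S\<close> are \<open>A\<close> followed
  by an element of \<open>W(S\<^sub>0) \<union> W(S\<^sub>1)\<close>, or \<open>B\<close> followed by an element of \<open>W(S\<^sub>0) \<inter> W(S\<^sub>1)\<close>.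
  Applied to the words of length \<open>n\<close> of the orbit closure, this turns the claim into the
  statement that the winning turn orders of length \<open>n\<close> are those with at most one \<open>B\<close> if and only
  if there are \<open>n + 1\<close> of them.  In the harder direction, complexity \<open>n + 1\<close> at every length
  produces for each \<open>i\<close> a winning turn order of length \<open>i + 1\<close> ending in \<open>B\<close>; since giving turns
  to \<open>A\<close> only helps \<open>A\<close>, the turn order \<open>A\<^sup>iB\<close> wins too.\<close>

section \<open>Prefixes of points and the game on finite words\<close>

definition tails :: "'a \<Rightarrow> (nat \<Rightarrow> 'a) set \<Rightarrow> (nat \<Rightarrow> 'a) set" where
  "tails c X = {w. case_nat c w \<in> X}"

definition prefixes_of_length :: "nat \<Rightarrow> (nat \<Rightarrow> 'a) set \<Rightarrow> 'a list set" where
  "prefixes_of_length n X = (\<lambda>w. map w [0..<n]) ` X"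

text \<open>A form of winning free of strategies: the turn order is read as a quantifier prefix,
  \<exists> for \<open>A\<close> and \<forall> for \<open>B\<close>, and \<open>S\<close> shrinks to
  the continuations of the letters chosen so far.\<close>

fun wins_word :: "player list \<Rightarrow> bool list set \<Rightarrow> bool" where
  "wins_word [] S \<longleftrightarrow> [] \<in> S"
| "wins_word (A # v) S \<longleftrightarrow> (\<exists>c. wins_word v {w. c # w \<in> S})"
| "wins_word (B # v) S \<longleftrightarrow> (\<forall>c. wins_word v {w. c # w \<in> S})"

definition winning_words :: "nat \<Rightarrow> bool list set \<Rightarrow> player list set" where
  "winning_words n S = {v. length v = n \<and> wins_word v S}"

definition extend_A :: "player list \<Rightarrow> nat \<Rightarrow> player" where
  "extend_A v i = (if i < length v then v ! i else A)"


lemma case_nat_shift: "case_nat (w 0) (shift w) = w"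
  by (auto simp: shift_def split: nat.split)

lemma map_upt_Suc_shift: "map w [0..<Suc n] = w 0 # map (shift w) [0..<n]"
  by (simp add: shift_def map_upt_Suc del: upt_Suc)

text \<open>Matches the recursion of \<open>wins_word\<close> on sets of words with the first-move
  recursion of \<open>winning_shift\<close> on sets of points.\<close>

lemma Cons_in_prefixes_of_length:
  "{w. c # w \<in> prefixes_of_length (Suc n) X} = prefixes_of_length n (tails c X)"
proof (intro set_eqI iffI)
  fix v assume "v \<in> {w. c # w \<in> prefixes_of_length (Suc n) X}"
  then obtain w where w: "w \<in> X" "c # v = map w [0..<Suc n]"
    by (auto simp: prefixes_of_length_def simp del: upt_Suc)
  then have "shift w \<in> tails c X" "v = map (shift w) [0..<n]"
    using case_nat_shift[of w] by (auto simp: map_upt_Suc_shift tails_def simp del: upt_Suc)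
  then show "v \<in> prefixes_of_length n (tails c X)"
    by (auto simp: prefixes_of_length_def)
next
  fix v assume "v \<in> prefixes_of_length n (tails c X)"
  then obtain w where w: "case_nat c w \<in> X" "v = map w [0..<n]"
    by (auto simp: prefixes_of_length_def tails_def)
  have "c # v = map (case_nat c w) [0..<Suc n]"
    using w(2) by (simp add: map_upt_Suc del: upt_Suc)
  then show "v \<in> {w. c # w \<in> prefixes_of_length (Suc n) X}"
    using w(1) by (auto simp: prefixes_of_length_def simp del: upt_Suc)
qed

section \<open>From the infinite game to the finite one\<close>

lemma play_prefix_Suc_shift:
  fixes sA sB :: strategy
  assumes "c = (case a 0 of A \<Rightarrow> sA [] | B \<Rightarrow> sB [])"
  shows "play_prefix a sA sB (Suc n)
    = c # play_prefix (shift a) (\<lambda>p. sA (c # p)) (\<lambda>p. sB (c # p)) n"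
proof (induction n)
  case (Suc n)
  have "play_prefix a sA sB (Suc (Suc n)) =
    (let p = play_prefix a sA sB (Suc n) in p @ [case a (Suc n) of A \<Rightarrow> sA p | B \<Rightarrow> sB p])"
    by (simp only: play_prefix.simps)
  then show ?case
    unfolding Suc.IH by (simp add: Let_def shift_def)
qed (simp add: assms)

text \<open>After the first letter \<open>c\<close> the rest is again a play, in which both
  strategies see \<open>c\<close> put back in front of the history.\<close>

lemma play_case_nat:
  fixes sA sB :: strategy
  assumes "c = (case a 0 of A \<Rightarrow> sA [] | B \<Rightarrow> sB [])"
  shows "play a sA sB
    = case_nat c (play (shift a) (\<lambda>p. sA (c # p)) (\<lambda>p. sB (c # p)))"
proof
  fix i
  show "play a sA sB i = case_nat c (play (shift a) (\<lambda>p. sA (c # p)) (\<lambda>p. sB (c # p))) i"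
    unfolding play_def[of a] play_prefix_Suc_shift[where c = c and a = a and sA = sA and sB = sB, OF assms]
    by (cases i) (simp_all add: play_def)
qed

lemma winning_shift_A:
  assumes "a 0 = A"
  shows "a \<in> winning_shift X \<longleftrightarrow> (\<exists>c. shift a \<in> winning_shift (tails c X))"
proof
  assume "a \<in> winning_shift X"
  then obtain sA where sA: "\<And>sB. play a sA sB \<in> X"
    by (auto simp: winning_shift_def)
  let ?c = "sA []"
  have "play (shift a) (\<lambda>p. sA (?c # p)) sB \<in> tails ?c X" for sB
    using sA[of "\<lambda>p. sB (tl p)"]
    by (simp add: play_case_nat[where c = "sA []" and a = a] assms tails_def)
  then show "\<exists>c. shift a \<in> winning_shift (tails c X)"
    unfolding winning_shift_def by blast
next
  assume "\<exists>c. shift a \<in> winning_shift (tails c X)"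
  then obtain c sA where sA: "\<And>sB. case_nat c (play (shift a) sA sB) \<in> X"
    by (auto simp: winning_shift_def tails_def)
  \<comment> \<open>Deleting the first letter loses nothing: it is always the \<open>c\<close> that
    \<open>A\<close> has chosen.\<close>
  have "play a (\<lambda>p. if p = [] then c else sA (tl p)) sB \<in> X" for sB
    using sA by (simp add: play_case_nat[where c = c and a = a] assms)
  then show "a \<in> winning_shift X"
    unfolding winning_shift_def by blast
qed

lemma winning_shift_B:
  assumes "a 0 = B"
  shows "a \<in> winning_shift X \<longleftrightarrow> (\<forall>c. shift a \<in> winning_shift (tails c X))"
proof
  assume "a \<in> winning_shift X"
  then obtain sA where sA: "\<And>sB. play a sA sB \<in> X"
    by (auto simp: winning_shift_def)
  \<comment> \<open>\<open>sA\<close> is tested against the opponent who opens with \<open>c\<close>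
    and then imitates \<open>sB\<close>.\<close>
  have "play (shift a) (\<lambda>p. sA (c # p)) sB \<in> tails c X" for sB c
    using sA[of "\<lambda>p. if p = [] then c else sB (tl p)"]
    by (simp add: play_case_nat[where c = c and a = a] assms tails_def)
  then show "\<forall>c. shift a \<in> winning_shift (tails c X)"
    unfolding winning_shift_def by blast
next
  assume "\<forall>c. shift a \<in> winning_shift (tails c X)"
  \<comment> \<open>Choice gives one strategy per opening letter; the combined strategy reads the
    opening from \<open>hd p\<close> and follows the matching one.\<close>
  then obtain sA where sA: "\<And>c sB. case_nat c (play (shift a) (sA c) sB) \<in> X"
    unfolding winning_shift_def tails_def mem_Collect_eq by metis
  have "play a (\<lambda>p. sA (hd p) (tl p)) sB \<in> X" for sB
    using sA[of "sB []" "\<lambda>p. sB (sB [] # p)"]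
    by (simp add: play_case_nat[where c = "sB []" and a = a] assms)
  then show "a \<in> winning_shift X"
    unfolding winning_shift_def by blast
qed

lemma winning_shift_imp_wins_word:
  "a \<in> winning_shift X \<Longrightarrow> wins_word (map a [0..<n]) (prefixes_of_length n X)"
proof (induction n arbitrary: a X)
  case 0
  then show ?case by (auto simp: winning_shift_def prefixes_of_length_def)
next
  case (Suc n)
  then show ?case
    by (cases "a 0")
      (auto simp: map_upt_Suc_shift Cons_in_prefixes_of_length winning_shift_A winning_shift_B
        simp del: upt_Suc)
qed

lemma shift_extend_A: "shift (extend_A (p # v)) = extend_A v"
  by (auto simp: shift_def extend_A_def)

lemma extend_A_Cons_0: "extend_A (p # v) 0 = p"
  by (simp add: extend_A_def)

lemma extend_A_Nil_in_winning_shift: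
  assumes "w \<in> X"
  shows "extend_A [] \<in> winning_shift X"
proof -
  have "play (extend_A []) (\<lambda>p. w (length p)) sB = w" for sB
    by (rule ext, subst play_rec) (simp add: extend_A_def)
  then show ?thesis
    using assms unfolding winning_shift_def mem_Collect_eq by metis
qed

text \<open>Holds for any \<open>X\<close>, closed or not: once \<open>v\<close> is used up,
  \<open>A\<close> moves alone and can follow a point of \<open>X\<close> that extends the word
  reached.\<close>

lemma wins_word_imp_winning_shift:
  "wins_word v (prefixes_of_length (length v) X) \<Longrightarrow> extend_A v \<in> winning_shift X"
proof (induction v arbitrary: X)
  case Nil
  then show ?case
    by (auto simp: prefixes_of_length_def intro: extend_A_Nil_in_winning_shift)
next
  case (Cons p v)
  then show ?case
    by (cases p)
      (auto simp: Cons_in_prefixes_of_length winning_shift_A winning_shift_B shift_extend_A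
        extend_A_Cons_0)
qed

lemma map_extend_A: "map (extend_A v) [0..<length v] = v"
  by (rule nth_equalityI) (auto simp: extend_A_def)

lemma winning_words_prefixes:
  "winning_words n (prefixes_of_length n X) = prefixes_of_length n (winning_shift X)"
proof (intro set_eqI iffI)
  fix v assume v: "v \<in> winning_words n (prefixes_of_length n X)"
  then have "extend_A v \<in> winning_shift X" "v = map (extend_A v) [0..<n]"
    using wins_word_imp_winning_shift[of v X] map_extend_A[of v]
    by (auto simp: winning_words_def)
  then show "v \<in> prefixes_of_length n (winning_shift X)"
    unfolding prefixes_of_length_def by blast
next
  fix v assume "v \<in> prefixes_of_length n (winning_shift X)"
  then obtain a where "a \<in> winning_shift X" "v = map a [0..<n]"
    by (auto simp: prefixes_of_length_def)
  then show "v \<in> winning_words n (prefixes_of_length n X)"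
    using winning_shift_imp_wins_word[of a X n] by (simp add: winning_words_def)
qed


section \<open>Counting the winning turn orders of a fixed length\<close>

lemma winning_words_Suc:
  "winning_words (Suc n) S =
    Cons A ` (winning_words n {w. False # w \<in> S} \<union> winning_words n {w. True # w \<in> S}) \<union>
    Cons B ` (winning_words n {w. False # w \<in> S} \<inter> winning_words n {w. True # w \<in> S})"
    (is "?L = ?R")
proof (rule set_eqI)
  fix v show "v \<in> ?L \<longleftrightarrow> v \<in> ?R"
  proof (cases v)
    case (Cons p u)
    then show ?thesis
      by (cases p) (auto simp: winning_words_def ex_bool_eq all_bool_eq)
  qed (auto simp: winning_words_def)
qed

lemma finite_winning_words: "finite (winning_words n S)"
  by (induction n arbitrary: S) (auto simp: winning_words_Suc, simp add: winning_words_def)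

lemma card_winning_words:
  assumes "S \<subseteq> {w. length w = n}"
  shows "card (winning_words n S) = card S"
  using assms
proof (induction n arbitrary: S)
  case 0
  then have "S = {} \<or> S = {[]}" by auto
  moreover have "winning_words 0 S = (if [] \<in> S then {[]} else {})"
    by (auto simp: winning_words_def)
  ultimately show ?case by auto
next
  case (Suc n)
  define S0 S1 where "S0 = {w. False # w \<in> S}" and "S1 = {w. True # w \<in> S}"
  have sub: "S0 \<subseteq> {w. length w = n}" "S1 \<subseteq> {w. length w = n}"
    using Suc.prems by (auto simp: S0_def S1_def)
  have fin: "finite {w :: bool list. length w = n}"
    using finite_lists_length_eq[of "UNIV :: bool set" n] by simp
  have S: "S = Cons False ` S0 \<union> Cons True ` S1"
  proof (rule set_eqI)
    fix w show "w \<in> S \<longleftrightarrow> w \<in> Cons False ` S0 \<union> Cons True ` S1"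
    proof (cases w)
      case (Cons c u)
      then show ?thesis by (cases c) (auto simp: S0_def S1_def)
    qed (use Suc.prems in auto)
  qed
  have "card (winning_words (Suc n) S) =
      card (Cons A ` (winning_words n S0 \<union> winning_words n S1)) +
      card (Cons B ` (winning_words n S0 \<inter> winning_words n S1))"
    unfolding winning_words_Suc S0_def[symmetric] S1_def[symmetric]
    by (rule card_Un_disjoint) (auto simp: finite_winning_words)
  \<comment> \<open>A union and an intersection together have as many elements as the two sets
    together.\<close>
  also have "\<dots> = card (winning_words n S0) + card (winning_words n S1)"
    by (simp add: card_image card_Un_Int[of "winning_words n S0"] finite_winning_words)
  also have "\<dots> = card S0 + card S1"
    using Suc.IH sub by simp
  also have "\<dots> = card (Cons False ` S0) + card (Cons True ` S1)"
    by (simp add: card_image)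
  also have "\<dots> = card S"
    unfolding S using finite_subset[OF sub(1) fin] finite_subset[OF sub(2) fin]
    by (intro card_Un_disjoint[symmetric]) auto
  finally show ?case .
qed

text \<open>Each \<open>B\<close> in \<open>v\<close> that becomes an \<open>A\<close> weakens a
  \<forall> over letters to an \<exists>.\<close>

lemma wins_word_replace_A:
  "wins_word (v @ w) S \<Longrightarrow> wins_word (replicate (length v) A @ w) S"
proof (induction v arbitrary: S)
  case (Cons p v)
  then show ?case by (cases p) auto
qed simp


section \<open>Turn orders with at most one \<open>B\<close>\<close>

definition at_most_one_B :: "(nat \<Rightarrow> player) set" where
  "at_most_one_B = {a. \<forall>i j. a i = B \<and> a j = B \<longrightarrow> i = j}"

text \<open>The index \<open>i = n\<close> lies beyond the word and stands for the prefix without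
  \<open>B\<close>; hence \<open>{..n}\<close>, with \<open>n + 1\<close> elements.\<close>

lemma prefixes_at_most_one_B:
  "prefixes_of_length n at_most_one_B =
    (\<lambda>i. map (\<lambda>j. if j = i then B else A) [0..<n]) ` {..n}"
proof (intro set_eqI iffI)
  fix v assume "v \<in> prefixes_of_length n at_most_one_B"
  then obtain a where "a \<in> at_most_one_B" and v: "v = map a [0..<n]"
    by (auto simp: prefixes_of_length_def)
  then have a: "a i = B \<Longrightarrow> a j = B \<Longrightarrow> i = j" for i j
    unfolding at_most_one_B_def by blast
  have not_B: "p = A \<longleftrightarrow> p \<noteq> B" for p by (cases p) auto
  show "v \<in> (\<lambda>i. map (\<lambda>j. if j = i then B else A) [0..<n]) ` {..n}"
  proof (cases "\<exists>i<n. a i = B")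
    case True
    then obtain i where "i < n" "a i = B" by blast
    then have "a j = B \<longleftrightarrow> j = i" for j
      using a by blast
    then have "v = map (\<lambda>j. if j = i then B else A) [0..<n]"
      by (simp add: v not_B)
    with \<open>i < n\<close> show ?thesis by auto
  next
    case False
    then have "v = map (\<lambda>j. if j = n then B else A) [0..<n]"
      by (auto simp: v not_B)
    then show ?thesis by auto
  qed
next
  fix v assume "v \<in> (\<lambda>i. map (\<lambda>j. if j = i then B else A) [0..<n]) ` {..n}"
  then obtain i where "v = map (\<lambda>j. if j = i then B else A) [0..<n]" by blast
  moreover have "(\<lambda>j. if j = i then B else A) \<in> at_most_one_B"
    by (auto simp: at_most_one_B_def split: if_splits)
  ultimately show "v \<in> prefixes_of_length n at_most_one_B"
    unfolding prefixes_of_length_def by blast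
qed

lemma card_prefixes_at_most_one_B: "card (prefixes_of_length n at_most_one_B) = n + 1"
proof -
  have "inj_on (\<lambda>i. map (\<lambda>j. if j = i then B else A) [0..<n]) {..n}"
  proof (rule linorder_inj_onI)
    fix i k assume "i < k" "i \<in> {..n}" "k \<in> {..n}"
    then have "map (\<lambda>j. if j = i then B else A) [0..<n] ! i \<noteq>
        map (\<lambda>j. if j = k then B else A) [0..<n] ! i"
      by simp
    then show "map (\<lambda>j. if j = i then B else A) [0..<n] \<noteq>
        map (\<lambda>j. if j = k then B else A) [0..<n]"
      by metis
  qed auto
  then show ?thesis
    by (simp add: prefixes_at_most_one_B card_image)
qed

text \<open>Both cases have the form \<open>extend_A v\<close>, so that winning on the finite word
  \<open>v\<close> suffices.\<close>

lemma at_most_one_B_cases: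
  assumes "a \<in> at_most_one_B"
  obtains "a = extend_A []" | i where "a = extend_A (replicate i A @ [B])"
proof (cases "\<exists>i. a i = B")
  case True
  then obtain i where i: "a i = B" by blast
  have "a j = extend_A (replicate i A @ [B]) j" for j
  proof (cases "j = i")
    case True
    then show ?thesis using i by (simp add: extend_A_def nth_append)
  next
    case False
    then have "a j = A"
      using assms i by (cases "a j") (auto simp: at_most_one_B_def)
    then show ?thesis using False by (auto simp: extend_A_def nth_append)
  qed
  then show ?thesis using that(2) by blast
next
  case False
  then have "a j = A" for j by (cases "a j") auto
  then have "a = extend_A []" by (auto simp: extend_A_def)
  then show ?thesis using that(1) by blast
qed

lemma append_in_prefixes_of_length:
  assumes "v @ [c] \<in> prefixes_of_length (Suc n) X"
  shows "v \<in> prefixes_of_length n X"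
  using assms by (auto simp: prefixes_of_length_def)

lemma at_most_one_B_in_winning_shift:
  assumes card: "\<And>n. card (prefixes_of_length n X) = n + 1"
    and a: "a \<in> at_most_one_B"
  shows "a \<in> winning_shift X"
proof -
  define W where "W n = prefixes_of_length n (winning_shift X)" for n
  have W: "W n = winning_words n (prefixes_of_length n X)" for n
    by (simp add: W_def winning_words_prefixes)
  have cardW: "card (W n) = n + 1" for n
  proof -
    have "prefixes_of_length n X \<subseteq> {w. length w = n}"
      by (auto simp: prefixes_of_length_def)
    then show ?thesis
      using card_winning_words card by (simp add: W)
  qed
  have finW: "finite (W n)" for n
    unfolding W by (rule finite_winning_words)
  from a show ?thesis
  proof (cases rule: at_most_one_B_cases)
    case 1
    have "X \<noteq> {}" using card[of 0] by (auto simp: prefixes_of_length_def)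
    then show ?thesis using 1 extend_A_Nil_in_winning_shift by blast
  next
    case (2 i)
    \<comment> \<open>If all words of \<open>W (Suc i)\<close> ended in \<open>A\<close>, each would
      be determined by its first \<open>i\<close> letters, a word of \<open>W i\<close>; that allows
      only \<open>i + 1\<close> words instead of \<open>i + 2\<close>.\<close>
    have "\<exists>v. v @ [B] \<in> W (Suc i)"
    proof (rule ccontr)
      assume no: "\<nexists>v. v @ [B] \<in> W (Suc i)"
      have "W (Suc i) \<subseteq> (\<lambda>v. v @ [A]) ` W i"
      proof
        fix u assume u: "u \<in> W (Suc i)"
        then have "u \<noteq> []" by (auto simp: W winning_words_def)
        then obtain v p where vp: "u = v @ [p]" by (metis rev_exhaust)
        with no u have "p = A" by (cases p) auto
        with u vp show "u \<in> (\<lambda>v. v @ [A]) ` W i"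
          using append_in_prefixes_of_length[of v A i] by (simp add: W_def)
      qed
      then have "card (W (Suc i)) \<le> card (W i)"
        using finW by (meson surj_card_le)
      then show False by (simp add: cardW)
    qed
    then obtain v where "v @ [B] \<in> W (Suc i)" by blast
    then have "wins_word (v @ [B]) (prefixes_of_length (Suc i) X)" "length v = i"
      by (auto simp: W winning_words_def)
    then have "wins_word (replicate i A @ [B]) (prefixes_of_length (Suc i) X)"
      using wins_word_replace_A by metis
    then show ?thesis
      using 2 wins_word_imp_winning_shift[of "replicate i A @ [B]" X] by simp
  qed
qed

lemma card_prefixes_iff_winning_shift:
  "(\<forall>n. card (prefixes_of_length n X) = n + 1) \<longleftrightarrow> winning_shift X = at_most_one_B"
proof -
  have card_eq: "card (prefixes_of_length n (winning_shift X)) = card (prefixes_of_length n X)" for n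
    unfolding winning_words_prefixes[symmetric]
    by (rule card_winning_words) (auto simp: prefixes_of_length_def)
  show ?thesis
  proof
    assume card: "\<forall>n. card (prefixes_of_length n X) = n + 1"
    then have sub: "at_most_one_B \<subseteq> winning_shift X"
      using at_most_one_B_in_winning_shift by blast
    \<comment> \<open>The inclusion is between finite sets that both have \<open>n + 1\<close>
      elements.\<close>
    have eq: "prefixes_of_length n at_most_one_B = prefixes_of_length n (winning_shift X)" for n
    proof (rule card_subset_eq)
      show "finite (prefixes_of_length n (winning_shift X))"
        unfolding winning_words_prefixes[symmetric] by (rule finite_winning_words)
      show "prefixes_of_length n at_most_one_B \<subseteq> prefixes_of_length n (winning_shift X)"
        using sub by (auto simp: prefixes_of_length_def)
    qed (simp add: card_prefixes_at_most_one_B card_eq card)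
    have "a \<in> at_most_one_B" if "a \<in> winning_shift X" for a
    proof -
      have "i = j" if ij: "a i = B" "a j = B" for i j
      proof -
        \<comment> \<open>This length is just enough for one prefix to show both positions
          \<open>i\<close> and \<open>j\<close>.\<close>
        have "map a [0..<Suc (max i j)] \<in> prefixes_of_length (Suc (max i j)) at_most_one_B"
          using \<open>a \<in> winning_shift X\<close> unfolding eq by (auto simp: prefixes_of_length_def)
        then obtain b where b: "b \<in> at_most_one_B"
          and ab: "map a [0..<Suc (max i j)] = map b [0..<Suc (max i j)]"
          by (auto simp: prefixes_of_length_def simp del: upt_Suc)
        have "a i = b i" "a j = b j"
          using ab unfolding map_eq_conv by (auto simp: less_Suc_eq_le)
        with b ij show ?thesis by (auto simp: at_most_one_B_def)
      qed
      then show ?thesis by (auto simp: at_most_one_B_def)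
    qed
    with sub show "winning_shift X = at_most_one_B" by blast
  next
    assume "winning_shift X = at_most_one_B"
    then show "\<forall>n. card (prefixes_of_length n X) = n + 1"
      using card_eq card_prefixes_at_most_one_B by metis
  qed
qed


section \<open>Shift invariance of orbit closures\<close>

lemma continuous_on_shift:
  "continuous_on S (shift :: (nat \<Rightarrow> 'a::topological_space) \<Rightarrow> nat \<Rightarrow> 'a)"
proof (rule continuous_on_coordinatewise_then_product)
  fix i
  have "continuous_on S (\<lambda>y :: nat \<Rightarrow> 'a. y (Suc i))"
    by (rule continuous_on_subset[OF continuous_on_product_coordinates]) simp
  then show "continuous_on S (\<lambda>y :: nat \<Rightarrow> 'a. shift y i)"
    by (simp add: shift_def)
qed

text \<open>The shift maps the orbit into itself, and by continuity its closure too.\<close>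

lemma shift_orbit_closure:
  assumes "y \<in> orbit_closure x"
  shows "shift y \<in> orbit_closure x"
proof -
  let ?O = "{(shift ^^ n) x | n. True}"
  have "shift ` ?O \<subseteq> closure ?O"
  proof
    fix z assume "z \<in> shift ` ?O"
    then obtain n where "z = (shift ^^ Suc n) x" by auto
    then have "z \<in> ?O" unfolding mem_Collect_eq by metis
    then show "z \<in> closure ?O" by (rule subsetD[OF closure_subset])
  qed
  then have "shift ` closure ?O \<subseteq> closure ?O"
    by (intro image_closure_subset continuous_on_shift) auto
  then show ?thesis using assms by (auto simp: orbit_closure_def)
qed

lemma funpow_shift: "(shift ^^ k) y = (\<lambda>i. y (k + i))"
  by (induction k) (auto simp: shift_def)

text \<open>Complexity counts factors at all positions, whereas the game sees only prefixes. By
  shift invariance a factor of \<open>y\<close> at position \<open>k\<close> is a prefix of another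
  point, \<open>(shift ^^ k) y\<close>.\<close>

lemma words_of_length_orbit_closure:
  "words_of_length n (orbit_closure x) = prefixes_of_length n (orbit_closure x)"
proof (intro set_eqI iffI)
  fix v assume "v \<in> words_of_length n (orbit_closure x)"
  then obtain y k where y: "y \<in> orbit_closure x" and v: "v = map y [k..<k + n]"
    by (auto simp: words_of_length_def)
  have "(shift ^^ k) y \<in> orbit_closure x"
    using y by (induction k) (auto intro: shift_orbit_closure)
  moreover have "v = map ((shift ^^ k) y) [0..<n]"
    unfolding v funpow_shift by (rule nth_equalityI) auto
  ultimately show "v \<in> prefixes_of_length n (orbit_closure x)"
    unfolding prefixes_of_length_def by blast
next
  fix v assume "v \<in> prefixes_of_length n (orbit_closure x)"
  then obtain y where "y \<in> orbit_closure x" "v = map y [0..<0 + n]"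
    by (auto simp: prefixes_of_length_def)
  then show "v \<in> words_of_length n (orbit_closure x)"
    unfolding words_of_length_def by blast
qed

theorem corollary4p3:
  fixes x :: "nat \<Rightarrow> bool"
  shows "sturmian x \<longleftrightarrow> winning_shift (orbit_closure x) = inverse_language AstarBAstar"
  unfolding sturmian_def words_of_length_orbit_closure card_prefixes_iff_winning_shift
    inverse_language_AstarBAstar at_most_one_B_def ..

end
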